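(* Let $S=\langle n_0,\ldots,n_p\rangle$ be a numerical semigroup on a compound sequence (NSCS), with associated integers $a_1,\ldots,a_p,b_1,\ldots,b_p$. Set $N=\{b_1-a_1,b_2-a_2,\ldots,b_p-a_p\}$. Then: 1. $\min(\Delta(S))=\gcd(N)$; 2. $N\subseteq\Delta(S)$; and 3. $\max(\Delta(S))=\max(N)$.
   Context: Let $\mathbb{N}$ be the positive integers and $\mathbb{N}_0$ the nonnegative integers. A compound sequence is a sequence $\{n_0,\ldots,n_p\}$ with $n_i=b_1b_2\cdots b_i\,a_{i+1}a_{i+2}\cdots a_p$ for $i\in[0,p]$, where $p,a_1,\ldots,a_p,b_1,\ldots,b_p\in\mathbb{N}$ satisfy $2\le a_i<b_i$ for all $i\in[1,p]$ and $\gcd(a_i,b_j)=1$ for all $i,j\in[1,p]$ with $i\ge j$. An NSCS is a numerical semigroup $S=\langle n_0,\ldots,n_p\rangle$ whose minimal generators form a compound sequence. The factorization homomorphism is $\phi:\mathbb{N}_0^{p+1}\to S$, $\phi(x_0,\ldots,x_p)=x_0n_0+\cdots+x_pn_p$; the elements of $\phi^{-1}(n)$ are the factorizations of $n$. The length of $x\in\mathbb{N}_0^{p+1}$ is $|x|=x_0+\cdots+x_p$. The length set of $n\in S$ is $\mathcal{L}(n)=\{|x|:x\in\phi^{-1}(n)\}=\{s_1<s_2<\cdots<s_k\}$, its delta set is $\Delta(n)=\{s_i-s_{i-1}:i\in[2,k]\}$ (empty if $|\mathcal{L}(n)|=1$), and $\Delta(S)=\bigcup_{n\in S}\Delta(n)$.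 *)

theory Defs
  imports Complex_Main
begin

definition add_submonoid :: "nat set \<Rightarrow> bool" where
  "add_submonoid T \<longleftrightarrow> 0 \<in> T \<and> (\<forall>x\<in>T. \<forall>y\<in>T. x + y \<in> T)"

definition numerical_semigroup :: "nat set \<Rightarrow> bool" where
  "numerical_semigroup S \<longleftrightarrow> add_submonoid S \<and> finite (- S)"

definition minimally_generates :: "nat set \<Rightarrow> nat set \<Rightarrow> bool" where
  "minimally_generates A S \<longleftrightarrow>
     add_submonoid hull A = S \<and> (\<forall>B. B \<subset> A \<longrightarrow> add_submonoid hull B \<noteq> S)"

text \<open>The integers \<open>a\<^sub>i\<close>, \<open>b\<^sub>i\<close> are the values \<open>a i\<close>, \<open>b i\<close> for \<open>1 \<le> i \<le> p\<close>; values at other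
  indices are irrelevant.\<close>

definition compound_params :: "nat \<Rightarrow> (nat \<Rightarrow> nat) \<Rightarrow> (nat \<Rightarrow> nat) \<Rightarrow> bool" where
  "compound_params p a b \<longleftrightarrow>
     1 \<le> p \<and>
     (\<forall>i\<in>{1..p}. 2 \<le> a i \<and> a i < b i) \<and>
     (\<forall>i\<in>{1..p}. \<forall>j\<in>{1..p}. j \<le> i \<longrightarrow> gcd (a i) (b j) = 1)"

definition compound_seq :: "nat \<Rightarrow> (nat \<Rightarrow> nat) \<Rightarrow> (nat \<Rightarrow> nat) \<Rightarrow> nat \<Rightarrow> nat" where
  "compound_seq p a b i = (\<Prod>j=1..i. b j) * (\<Prod>j=i+1..p. a j)"

definition nscs :: "nat \<Rightarrow> (nat \<Rightarrow> nat) \<Rightarrow> (nat \<Rightarrow> nat) \<Rightarrow> nat set \<Rightarrow> bool" where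
  "nscs p a b S \<longleftrightarrow>
     compound_params p a b \<and>
     numerical_semigroup S \<and>
     minimally_generates (compound_seq p a b ` {0..p}) S"

text \<open>An element of \<open>\<nat>\<^sub>0\<^bsup>p+1\<^esup>\<close> is represented by a function \<open>x\<close> vanishing outside \<open>{0..p}\<close>.\<close>

definition factorizations :: "nat \<Rightarrow> (nat \<Rightarrow> nat) \<Rightarrow> nat \<Rightarrow> (nat \<Rightarrow> nat) set" where
  "factorizations p n m = {x. (\<forall>i>p. x i = 0) \<and> (\<Sum>i=0..p. x i * n i) = m}"

definition length_set :: "nat \<Rightarrow> (nat \<Rightarrow> nat) \<Rightarrow> nat \<Rightarrow> nat set" where
  "length_set p n m = (\<lambda>x. \<Sum>i=0..p. x i) ` factorizations p n m"

definition successive_differences :: "nat set \<Rightarrow> nat set" where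
  "successive_differences L =
     {t - s | s t. s \<in> L \<and> t \<in> L \<and> s < t \<and> (\<forall>u\<in>L. \<not> (s < u \<and> u < t))}"

lemma successive_differences_sorted_list:
  assumes "finite L"
  shows "successive_differences L =
    {sorted_list_of_set L ! i - sorted_list_of_set L ! (i - 1) | i. i \<in> {1..<card L}}"
proof -
  define l where "l = sorted_list_of_set L"
  have len: "length l = card L" and st: "set l = L" using assms by (auto simp: l_def)
  have lt: "l ! i < l ! j \<longleftrightarrow> i < j" if "i < card L" "j < card L" for i j
  proof -
    have sw: "sorted_wrt (<) l" by (simp add: l_def)
    show ?thesis
      using sorted_wrt_nth_less[OF sw, of i j] sorted_wrt_nth_less[OF sw, of j i] that len
      by (cases i j rule: linorder_cases) auto
  qed
  have "successive_differences L = {l ! i - l ! (i - 1) | i. i \<in> {1..<card L}}"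
  proof (intro equalityI subsetI)
    fix d assume "d \<in> successive_differences L"
    then obtain s t where d: "d = t - s" "s \<in> L" "t \<in> L" "s < t"
      and no: "\<forall>u\<in>L. \<not> (s < u \<and> u < t)" by (auto simp: successive_differences_def)
    obtain i j where ij: "s = l ! i" "i < card L" "t = l ! j" "j < card L"
      using d st len by (metis in_set_conv_nth)
    have "i < j" using lt[of i j] ij d by simp
    moreover have "j = Suc i"
    proof (rule ccontr)
      assume "j \<noteq> Suc i"
      then have "Suc i < j" using \<open>i < j\<close> by simp
      then have "l ! i < l ! Suc i" "l ! Suc i < l ! j" "l ! Suc i \<in> L"
        using lt ij st len nth_mem[of "Suc i" l] by auto
      then show False using no ij by auto
    qed
    ultimately show "d \<in> {l ! i - l ! (i - 1) | i. i \<in> {1..<card L}}"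
      using d ij by force
  next
    fix d assume "d \<in> {l ! i - l ! (i - 1) | i. i \<in> {1..<card L}}"
    then obtain i where i: "d = l ! i - l ! (i - 1)" "1 \<le> i" "i < card L" by auto
    have "l ! i \<in> L" "l ! (i - 1) \<in> L" using i st len nth_mem by auto
    moreover have "l ! (i - 1) < l ! i" using lt i by simp
    moreover have "\<not> (l ! (i - 1) < u \<and> u < l ! i)" if u: "u \<in> L" for u
    proof -
      obtain k where "u = l ! k" "k < card L" using u st len by (metis in_set_conv_nth)
      then show ?thesis using lt[of "i - 1" k] lt[of k i] i by auto
    qed
    ultimately show "d \<in> successive_differences L"
      using i unfolding successive_differences_def by blast
  qed
  then show ?thesis by (simp add: l_def)
qed

definition delta :: "nat \<Rightarrow> (nat \<Rightarrow> nat) \<Rightarrow> nat \<Rightarrow> nat set" where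
  "delta p n m = successive_differences (length_set p n m)"

definition delta_set :: "nat \<Rightarrow> (nat \<Rightarrow> nat) \<Rightarrow> nat set \<Rightarrow> nat set" where
  "delta_set p n S = (\<Union>m\<in>S. delta p n m)"

end

theory Submission
  imports Defs
begin

text \<open>
  Since \<open>a\<^sub>i n\<^sub>i = b\<^sub>i n\<^sub>i\<^sub>-\<^sub>1\<close>, a factorization with \<open>x\<^sub>i \<ge> a\<^sub>i\<close> can trade \<open>a\<^sub>i\<close> copies of \<open>n\<^sub>i\<close> for
  \<open>b\<^sub>i\<close> copies of \<open>n\<^sub>i\<^sub>-\<^sub>1\<close>, which increases the length by \<open>b\<^sub>i - a\<^sub>i\<close>. Trading until no longer possible
  leads to a factorization with \<open>x\<^sub>i < a\<^sub>i\<close> for all \<open>i \<ge> 1\<close>, and by coprimality every element has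
  only one such factorization, which is therefore its longest one. Hence all lengths of an element
  agree modulo \<open>gcd N\<close>, and a length that is not maximal is followed by another one at distance at
  most \<open>max N\<close>. The differences of lengths of factorizations of a common element form a subgroup of
  the integers, so \<open>gcd N\<close> is such a difference, and nothing can lie in between. Finally,
  \<open>b\<^sub>i - a\<^sub>i\<close> is attained at \<open>a\<^sub>i n\<^sub>i\<close>: by coprimality every factorization of this element uses either
  only generators of index less than \<open>i\<close>, so its length is at least \<open>b\<^sub>i\<close>, or only generators of
  index at least \<open>i\<close>, so its length is at most \<open>a\<^sub>i\<close>.
\<close>

section \<open>Generated submonoids, integer gcds and bounded lengths\<close>

lemma sum_in_add_submonoid_hull:
  assumes "finite I"
  shows "(\<Sum>i\<in>I. x i * n i) \<in> add_submonoid hull (n ` I)"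
proof -
  have "(\<Sum>i\<in>I. x i * n i) \<in> T" if T: "add_submonoid T" and sub: "n ` I \<subseteq> T" for T
  proof -
    have mult: "k * y \<in> T" if "y \<in> T" for k y
      using T that by (induction k) (auto simp: add_submonoid_def)
    show ?thesis
      using assms sub T by (induction I rule: finite_induct) (auto simp: add_submonoid_def mult)
  qed
  then show ?thesis by (auto simp: hull_def)
qed

text \<open>\<open>G\<close> is a subgroup of the integers, so it contains all integer combinations
  of \<open>F\<close>; Bezout makes the gcd one of them.\<close>

lemma Gcd_mem_if_closed_diff:
  fixes F G :: "int set"
  assumes "finite F" "F \<subseteq> G" "0 \<in> G" and diff: "\<And>x y. x \<in> G \<Longrightarrow> y \<in> G \<Longrightarrow> x - y \<in> G"
  shows "Gcd F \<in> G"
proof -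
  have uminus: "- x \<in> G" if "x \<in> G" for x
    using diff[OF \<open>0 \<in> G\<close> that] by simp
  have add: "x + y \<in> G" if "x \<in> G" "y \<in> G" for x y
    using diff[OF that(1) uminus[OF that(2)]] by simp
  have "int k * x \<in> G" if "x \<in> G" for k x
    using add that \<open>0 \<in> G\<close> by (induction k) (auto simp: algebra_simps)
  then have mult: "k * x \<in> G" if "x \<in> G" for k x
    using uminus that by (cases k rule: int_cases2) auto
  from assms(1,2) show ?thesis
  proof (induction F rule: finite_induct)
    case empty
    then show ?case using \<open>0 \<in> G\<close> by simp
  next
    case (insert x F)
    obtain u v where "u * x + v * Gcd F = gcd x (Gcd F)"
      using bezout_int by blast
    then show ?case using insert add mult by (metis Gcd_insert insert_subset)
  qed
qed

lemma factorizations_le: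
  assumes "x \<in> factorizations p n m" "\<And>i. i \<le> p \<Longrightarrow> 0 < n i"
  shows "(\<Sum>i=0..p. x i) \<le> m"
proof -
  have "(\<Sum>i=0..p. x i) \<le> (\<Sum>i=0..p. x i * n i)"
    by (rule sum_mono) (use assms(2) in \<open>auto simp: Suc_leI\<close>)
  then show ?thesis using assms(1) by (simp add: factorizations_def)
qed

section \<open>Arithmetic of compound sequences\<close>

locale compound =
  fixes p :: nat and a b :: "nat \<Rightarrow> nat"
  assumes params: "compound_params p a b"
begin

abbreviation n :: "nat \<Rightarrow> nat" where
  "n \<equiv> compound_seq p a b"

abbreviation len :: "(nat \<Rightarrow> nat) \<Rightarrow> nat" where
  "len x \<equiv> \<Sum>i=0..p. x i"

abbreviation N :: "nat set" where
  "N \<equiv> {b i - a i | i. i \<in> {1..p}}"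

lemma
  assumes "i \<in> {1..p}"
  shows a_less_b: "a i < b i" and a_pos: "0 < a i" and b_pos: "0 < b i"
proof -
  have "2 \<le> a i \<and> a i < b i"
    using params assms unfolding compound_params_def by blast
  then show "a i < b i" "0 < a i" "0 < b i" by auto
qed

text \<open>Each index on the left is at least \<open>i\<close> and each on the right at most
  \<open>i\<close>, which is just the range of the gcd condition; \<open>i\<close> itself occurs on
  both sides.\<close>

lemma coprime_prods:
  assumes "i \<in> {1..p}"
  shows "coprime (\<Prod>j=i..p. a j) (\<Prod>j=1..i. b j)"
  by (intro prod_coprime_left prod_coprime_right)
    (use assms params in \<open>auto simp: compound_params_def coprime_iff_gcd_eq_1\<close>)

lemma n_pos: "i \<le> p \<Longrightarrow> 0 < n i"
  unfolding compound_seq_def using a_pos b_pos by (auto intro!: prod_pos)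

lemma prod_a_Suc:
  assumes "i \<in> {1..p}"
  shows "(\<Prod>j=i..p. a j) = a i * (\<Prod>j=i+1..p. a j)"
  using assms by (simp add: prod.atLeast_Suc_atMost)

lemma a_times_n:
  assumes "i \<in> {1..p}"
  shows "a i * n i = (\<Prod>j=i..p. a j) * (\<Prod>j=1..i. b j)"
  unfolding prod_a_Suc[OF assms] compound_seq_def by simp

lemma b_times_n:
  assumes "i \<in> {1..p}"
  shows "b i * n (i - 1) = a i * n i"
proof -
  obtain k where "i = Suc k" using assms by (cases i) auto
  then show ?thesis
    using prod_a_Suc[OF assms] unfolding a_times_n[OF assms] compound_seq_def by simp
qed

lemma n_mono: "i \<le> j \<Longrightarrow> j \<le> p \<Longrightarrow> n i \<le> n j"
proof (induction j rule: dec_induct)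
  case (step j)
  have "a (Suc j) * n j \<le> b (Suc j) * n j"
    using a_less_b[of "Suc j"] step by simp
  also have "\<dots> = a (Suc j) * n (Suc j)"
    using b_times_n[of "Suc j"] step by simp
  finally have "n j \<le> n (Suc j)" using a_pos[of "Suc j"] step by simp
  then show ?case using step by simp
qed simp

lemma prod_a_dvd_n:
  assumes "j < i"
  shows "(\<Prod>k=i..p. a k) dvd n j"
  unfolding compound_seq_def
  by (rule dvd_mult, rule prod_dvd_prod_subset) (use assms in auto)

lemma prod_b_dvd_n:
  assumes "i \<le> j"
  shows "(\<Prod>k=1..i. b k) dvd n j"
  unfolding compound_seq_def
  by (rule dvd_mult2, rule prod_dvd_prod_subset) (use assms in auto)

section \<open>Lengths of factorizations of \<open>a i * n i\<close>\<close>

lemma length_dichotomy: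
  assumes i: "i \<in> {1..p}" and x: "x \<in> factorizations p n (a i * n i)"
  shows "len x \<le> a i \<or> b i \<le> len x"
proof -
  define A where "A = (\<Sum>j=0..<i. x j * n j)"
  define B where "B = (\<Sum>j=i..p. x j * n j)"
  have split: "sum f {0..p} = sum f {0..<i} + sum f {i..p}" for f :: "nat \<Rightarrow> nat"
    using i sum.atLeastLessThan_concat[of 0 i "Suc p" f] by (simp add: atLeastLessThanSuc_atLeastAtMost)
  have AB: "A + B = a i * n i"
    using x split[of "\<lambda>j. x j * n j"] by (simp add: factorizations_def A_def B_def)
  have "(\<Prod>k=i..p. a k) dvd A"
    unfolding A_def by (intro dvd_sum dvd_mult prod_a_dvd_n) auto
  moreover have "(\<Prod>k=1..i. b k) dvd B"
    unfolding B_def by (intro dvd_sum dvd_mult prod_b_dvd_n) auto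
  then have "(\<Prod>k=1..i. b k) dvd A"
    using AB a_times_n[OF i] by (metis dvd_add_left_iff dvd_triv_right)
  \<comment> \<open>The two products are coprime and multiply to \<open>a i * n i\<close>. As
    \<open>A\<close> is at most this number, either \<open>A\<close> or \<open>B\<close>
    vanishes.\<close>
  ultimately have "a i * n i dvd A"
    using coprime_prods[OF i] a_times_n[OF i] by (simp add: divides_mult)
  then have "A = 0 \<or> A = a i * n i"
    using AB by (metis dvd_imp_le le_add1 le_antisym not_gr_zero)
  then show ?thesis
  proof
    assume "A = 0"
    then have "x j = 0" if "j < i" for j
      using that n_pos[of j] i unfolding A_def by (auto simp: sum_eq_0_iff)
    then have "len x = (\<Sum>j=i..p. x j)" by (simp add: split)
    \<comment> \<open>Only generators of index at least \<open>i\<close> occur, and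
      \<open>n i\<close> is the smallest of them.\<close>
    then have "len x * n i = (\<Sum>j=i..p. x j * n i)" by (simp add: sum_distrib_right)
    also have "\<dots> \<le> B"
      unfolding B_def by (intro sum_mono mult_left_mono n_mono) auto
    finally have "len x * n i \<le> a i * n i" using AB by linarith
    then show ?thesis using n_pos[of i] i by simp
  next
    assume A: "A = a i * n i"
    then have "B = 0" using AB by simp
    then have "x j = 0" if "i \<le> j" "j \<le> p" for j
      using that n_pos[of j] i unfolding B_def by (auto simp: sum_eq_0_iff)
    then have len: "len x = (\<Sum>j=0..<i. x j)" by (simp add: split)
    \<comment> \<open>Dually, \<open>n (i - 1)\<close> is the largest generator that occurs.\<close>
    have "b i * n (i - 1) = A" using A b_times_n[OF i] by simp
    also have "\<dots> \<le> (\<Sum>j=0..<i. x j * n (i - 1))"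
      unfolding A_def by (intro sum_mono mult_left_mono n_mono) (use i in auto)
    also have "\<dots> = len x * n (i - 1)" by (simp add: len sum_distrib_right)
    finally show ?thesis using n_pos[of "i - 1"] i by (simp add: le_diff_conv)
  qed
qed

section \<open>Trades and reduced factorizations\<close>

lemma trade:
  assumes x: "x \<in> factorizations p n m" and i: "i \<in> {1..p}" and le: "a i \<le> x i"
  obtains y where "y \<in> factorizations p n m" "len y = len x + (b i - a i)"
proof
  define y where "y = x(i := x i - a i, i - 1 := x (i - 1) + b i)"
  have y: "y j + (if j = i then a i else 0) = x j + (if j = i - 1 then b i else 0)" for j
    using i le by (auto simp: y_def)
  \<comment> \<open>One identity serves twice: the weight \<open>n\<close> shows that the element is
    unchanged, the weight 1 gives the change in length.\<close>
  have sum: "(\<Sum>j=0..p. y j * w j) + a i * w i = (\<Sum>j=0..p. x j * w j) + b i * w (i - 1)" for w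
  proof -
    have "(\<Sum>j=0..p. y j * w j) + a i * w i
        = (\<Sum>j=0..p. (y j + (if j = i then a i else 0)) * w j)"
      using i by (simp add: distrib_right sum.distrib if_distrib[of "\<lambda>c. c * _"] cong: if_cong)
    also have "\<dots> = (\<Sum>j=0..p. x j * w j) + b i * w (i - 1)"
      unfolding y using i le_trans[OF diff_le_self, of i p 1]
      by (simp add: distrib_right sum.distrib if_distrib[of "\<lambda>c. c * _"] cong: if_cong)
    finally show ?thesis .
  qed
  show "y \<in> factorizations p n m"
    using sum[of n] x b_times_n[OF i] i by (auto simp: factorizations_def y_def)
  show "len y = len x + (b i - a i)"
    using sum[of "\<lambda>_. 1"] a_less_b[OF i] by simp
qed

definition reduced :: "(nat \<Rightarrow> nat) \<Rightarrow> bool" where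
  "reduced x \<longleftrightarrow> (\<forall>i\<in>{1..p}. x i < a i)"

text \<open>Peel off the top coordinate: all lower terms are divisible by
  \<open>a (Suc k) * P\<close>, so the top coordinates agree modulo \<open>a (Suc k)\<close> once
  \<open>P\<close> and the coprime \<open>Q\<close> are cancelled, and both are below that modulus.
  Coordinate 0 carries no bound; the remaining sum determines it.\<close>

lemma reduced_unique:
  assumes "k \<le> p" and "\<forall>i\<in>{1..k}. x i < a i" and "\<forall>i\<in>{1..k}. y i < a i"
    and "(\<Sum>i=0..k. x i * n i) = (\<Sum>i=0..k. y i * n i)"
  shows "\<forall>i\<le>k. x i = y i"
  using assms
proof (induction k)
  case 0
  then show ?case using n_pos[of 0] by simp
next
  case (Suc k)
  have i: "Suc k \<in> {1..p}" using Suc.prems by simp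
  define P where "P = (\<Prod>j=Suc k+1..p. a j)"
  define Q where "Q = (\<Prod>j=1..Suc k. b j)"
  have "P > 0" unfolding P_def using a_pos by (auto intro!: prod_pos)
  have PQ: "n (Suc k) = P * Q"
    unfolding compound_seq_def P_def Q_def by (rule mult.commute)
  have dvd: "int (a (Suc k) * P) dvd (\<Sum>i=0..k. int (z i * n i))" for z
    unfolding P_def prod_a_Suc[OF i, symmetric]
    by (intro dvd_sum) (simp add: prod_a_dvd_n flip: of_nat_mult of_nat_prod)
  have "(\<Sum>i=0..k. int (x i * n i)) + int (x (Suc k) * n (Suc k))
      = (\<Sum>i=0..k. int (y i * n i)) + int (y (Suc k) * n (Suc k))"
    using arg_cong[OF Suc.prems(4), of int] by simp
  then have "(int (x (Suc k)) - int (y (Suc k))) * int Q * int P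
      = (\<Sum>i=0..k. int (y i * n i)) - (\<Sum>i=0..k. int (x i * n i))"
    by (simp add: PQ algebra_simps)
  then have "int (a (Suc k)) * int P dvd (int (x (Suc k)) - int (y (Suc k))) * int Q * int P"
    using dvd_diff[OF dvd dvd] by simp
  then have "int (a (Suc k)) dvd (int (x (Suc k)) - int (y (Suc k))) * int Q"
    using \<open>P > 0\<close> by simp
  moreover have "coprime (int (a (Suc k))) (int Q)"
    using coprime_prods[OF i] unfolding prod_a_Suc[OF i] Q_def
    by (simp only: coprime_int_iff coprime_mult_left_iff)
  ultimately have "int (a (Suc k)) dvd int (x (Suc k)) - int (y (Suc k))"
    by (simp add: coprime_dvd_mult_left_iff)
  moreover have "x (Suc k) < a (Suc k)" "y (Suc k) < a (Suc k)"
    using Suc.prems by auto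
  ultimately have eq: "x (Suc k) = y (Suc k)"
    using zdvd_imp_le[of "int (a (Suc k))" "int (x (Suc k)) - int (y (Suc k))"]
      zdvd_imp_le[of "int (a (Suc k))" "int (y (Suc k)) - int (x (Suc k))"]
    by (cases "x (Suc k)" "y (Suc k)" rule: linorder_cases) (auto simp: dvd_diff_commute)
  have "(\<Sum>i=0..k. x i * n i) = (\<Sum>i=0..k. y i * n i)"
    using Suc.prems(4) eq by simp
  then have "\<forall>i\<le>k. x i = y i"
    by (intro Suc.IH) (use Suc.prems(1-3) in auto)
  then show ?case using eq by (auto simp: le_Suc_eq)
qed

lemma reduced_len_eq:
  assumes "x \<in> factorizations p n m" "y \<in> factorizations p n m" "reduced x" "reduced y"
  shows "len x = len y"
  using reduced_unique[of p x y] assms by (auto simp: reduced_def factorizations_def)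

text \<open>Trades terminate because each raises the length, which never exceeds \<open>m\<close>.
  Since \<open>d\<close> is a natural number, the result also says that the reduced factorization is
  at least as long as \<open>x\<close>.\<close>

lemma ex_reduced:
  assumes "x \<in> factorizations p n m"
  shows "\<exists>y \<in> factorizations p n m. reduced y \<and> (\<exists>d. len y = len x + Gcd N * d)"
  using assms
proof (induction "m - len x" arbitrary: x rule: less_induct)
  case less
  show ?case
  proof (cases "reduced x")
    case True
    then show ?thesis using less.prems by (intro bexI[of _ x] conjI exI[of _ 0]) auto
  next
    case False
    then obtain i where i: "i \<in> {1..p}" "a i \<le> x i" by (auto simp: reduced_def not_less)
    obtain y where y: "y \<in> factorizations p n m" "len y = len x + (b i - a i)"
      using trade[OF less.prems i] .
    have "len y \<le> m" using factorizations_le[OF y(1) n_pos] .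
    then have "m - len y < m - len x" using y(2) a_less_b[OF i(1)] by linarith
    from less.hyps[OF this y(1)] obtain z d where
      z: "z \<in> factorizations p n m" "reduced z" "len z = len y + Gcd N * d" by blast
    have "Gcd N dvd b i - a i" using i by (intro Gcd_dvd) auto
    then obtain e where "b i - a i = Gcd N * e" by (elim dvdE)
    then have "len z = len x + Gcd N * (e + d)" using y z by (simp add: distrib_left)
    then show ?thesis using z by blast
  qed
qed

lemma Gcd_dvd_len_diff:
  assumes "x \<in> factorizations p n m" "y \<in> factorizations p n m"
  shows "Gcd N dvd len y - len x"
proof -
  obtain x' d where x': "x' \<in> factorizations p n m" "reduced x'" "len x' = len x + Gcd N * d"
    using ex_reduced[OF assms(1)] by blast
  obtain y' e where y': "y' \<in> factorizations p n m" "reduced y'" "len y' = len y + Gcd N * e"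
    using ex_reduced[OF assms(2)] by blast
  have "len x + Gcd N * d = len y + Gcd N * e"
    using reduced_len_eq[OF x'(1) y'(1) x'(2) y'(2)] x' y' by simp
  \<comment> \<open>Both subtractions truncate together: if \<open>y\<close> is the shorter one,
    both sides are 0.\<close>
  then have "len y - len x = Gcd N * (d - e)"
    by (simp add: diff_mult_distrib2)
  then show ?thesis by simp
qed

section \<open>Bounds on the delta set and attained values\<close>

lemma delta_le_Max:
  assumes "d \<in> delta p n m"
  shows "d \<le> Max N"
proof -
  obtain x y where x: "x \<in> factorizations p n m" and y: "y \<in> factorizations p n m"
    and d: "d = len y - len x" and less: "len x < len y"
    and gap: "\<And>z. z \<in> factorizations p n m \<Longrightarrow> \<not> (len x < len z \<and> len z < len y)"
    using assms by (auto simp: delta_def successive_differences_def length_set_def)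
  have "\<not> reduced x"
  proof
    assume "reduced x"
    obtain z e where "z \<in> factorizations p n m" "reduced z" "len z = len y + Gcd N * e"
      using ex_reduced[OF y] by blast
    then show False using reduced_len_eq[OF x _ \<open>reduced x\<close>] less by force
  qed
  then obtain i where i: "i \<in> {1..p}" "a i \<le> x i" by (auto simp: reduced_def not_less)
  obtain z where z: "z \<in> factorizations p n m" "len z = len x + (b i - a i)"
    using trade[OF x i] .
  \<comment> \<open>\<open>z\<close> is longer than \<open>x\<close>, and no length lies strictly
    between those of \<open>x\<close> and \<open>y\<close>, so \<open>z\<close> is at least as long
    as \<open>y\<close>.\<close>
  then have "d \<le> b i - a i" using gap[OF z(1)] d a_less_b[OF i(1)] by linarith
  also have "\<dots> \<le> Max N" using i by (intro Max_ge) auto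
  finally show ?thesis .
qed

lemma Gcd_dvd_delta:
  assumes "d \<in> delta p n m"
  shows "Gcd N dvd d" "0 < d"
proof -
  obtain x y where "x \<in> factorizations p n m" "y \<in> factorizations p n m"
    "d = len y - len x" "len x < len y"
    using assms by (auto simp: delta_def successive_differences_def length_set_def)
  then show "Gcd N dvd d" "0 < d"
    using Gcd_dvd_len_diff[of x m y] by (simp_all only: zero_less_diff)
qed

lemma generator_pair:
  assumes i: "i \<in> {1..p}"
  obtains x y where "x \<in> factorizations p n (a i * n i)" "len x = a i"
    "y \<in> factorizations p n (a i * n i)" "len y = b i"
proof
  let ?x = "\<lambda>j. if j = i then a i else 0" and ?y = "\<lambda>j. if j = i - 1 then b i else 0"
  show "?x \<in> factorizations p n (a i * n i)" "len ?x = a i" "len ?y = b i"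
    "?y \<in> factorizations p n (a i * n i)"
    using i b_times_n[OF i] le_trans[OF diff_le_self, of i p 1]
    by (simp_all add: factorizations_def if_distrib[of "\<lambda>c. c * _"] cong: if_cong)
qed

lemma N_delta:
  assumes i: "i \<in> {1..p}"
  shows "b i - a i \<in> delta p n (a i * n i)"
proof -
  obtain x y where "x \<in> factorizations p n (a i * n i)" "len x = a i"
    "y \<in> factorizations p n (a i * n i)" "len y = b i"
    using generator_pair[OF i] .
  then have "a i \<in> length_set p n (a i * n i)" "b i \<in> length_set p n (a i * n i)"
    unfolding length_set_def by (metis imageI)+
  moreover have "\<forall>u \<in> length_set p n (a i * n i). \<not> (a i < u \<and> u < b i)"
    using length_dichotomy[OF i] by (force simp: length_set_def)
  ultimately show ?thesis
    unfolding delta_def successive_differences_def using a_less_b[OF i] by blast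
qed

lemma Gcd_delta:
  obtains m where "Gcd N \<in> delta p n m"
proof -
  \<comment> \<open>The element \<open>m\<close> varies with the pair; this freedom is what makes
    \<open>G\<close> closed under subtraction.\<close>
  define G where "G = {int (len x) - int (len y) | x y m.
    x \<in> factorizations p n m \<and> y \<in> factorizations p n m}"
  have GI: "int (len x) - int (len y) \<in> G"
    if "x \<in> factorizations p n m" "y \<in> factorizations p n m" for x y m
    using that unfolding G_def by blast
  have "1 \<in> {1..p}" using params by (simp add: compound_params_def)
  then have "0 < b 1 - a 1" "b 1 - a 1 \<in> N" using a_less_b[of 1] by auto
  then have pos: "0 < Gcd N" by (rule dvd_pos_nat[OF _ Gcd_dvd])
  have add: "(\<lambda>i. x i + y i) \<in> factorizations p n (m + k)"
    if "x \<in> factorizations p n m" "y \<in> factorizations p n k" for x y m k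
    using that by (auto simp: factorizations_def distrib_right sum.distrib)
  have "Gcd (int ` N) \<in> G"
  proof (rule Gcd_mem_if_closed_diff)
    show "int ` N \<subseteq> G"
    proof
      fix d assume "d \<in> int ` N"
      then obtain i where i: "i \<in> {1..p}" "d = int (b i - a i)" by auto
      obtain x y where xy: "x \<in> factorizations p n (a i * n i)" "len x = a i"
        "y \<in> factorizations p n (a i * n i)" "len y = b i"
        using generator_pair[OF i(1)] .
      have "d = int (len y) - int (len x)" using i xy a_less_b[OF i(1)] by simp
      then show "d \<in> G" using GI[OF xy(3,1)] by simp
    qed
    have "(\<lambda>_. 0) \<in> factorizations p n 0" by (simp add: factorizations_def)
    from GI[OF this this] show "0 \<in> G" by simp
    fix u v assume "u \<in> G" "v \<in> G"
    then obtain x y m x' y' k where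
      xy: "u = int (len x) - int (len y)" "x \<in> factorizations p n m" "y \<in> factorizations p n m"
        "v = int (len x') - int (len y')" "x' \<in> factorizations p n k" "y' \<in> factorizations p n k"
      unfolding G_def by blast
    \<comment> \<open>Adding the pairs crosswise gives two factorizations of
      \<open>m + k\<close>.\<close>
    have "u - v = int (len (\<lambda>i. x i + y' i)) - int (len (\<lambda>i. y i + x' i))"
      using xy by (simp add: sum.distrib)
    then show "u - v \<in> G" using GI[OF add[OF xy(2,6)] add[OF xy(3,5)]] by simp
  qed simp
  moreover have "Gcd (int ` N) = int (Gcd N)" by (rule Gcd_int_eq)
  ultimately obtain x y m where x: "x \<in> factorizations p n m" and y: "y \<in> factorizations p n m"
    and eq: "int (Gcd N) = int (len x) - int (len y)"
    unfolding G_def by auto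
  have len: "len x = len y + Gcd N" using eq by linarith
  have "\<not> (len y < u \<and> u < len x)" if u: "u \<in> length_set p n m" for u
  proof -
    obtain z where z: "z \<in> factorizations p n m" "u = len z"
      using u unfolding length_set_def by blast
    show ?thesis
      using dvd_imp_le[OF Gcd_dvd_len_diff[OF y z(1)]] len z(2) by linarith
  qed
  moreover have "len x \<in> length_set p n m" "len y \<in> length_set p n m"
    using x y unfolding length_set_def by blast+
  moreover have "Gcd N = len x - len y" "len y < len x" using len pos by auto
  ultimately have "Gcd N \<in> delta p n m"
    unfolding delta_def successive_differences_def by blast
  then show thesis by (rule that)
qed

text \<open>A nonempty \<open>delta\<close> provides a factorization of \<open>m\<close>, which
  places \<open>m\<close> in the generated semigroup.\<close>

lemma delta_in_delta_set:
  assumes "d \<in> delta p n m" "add_submonoid hull (n ` {0..p}) = S"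
  shows "d \<in> delta_set p n S"
proof -
  obtain x where "x \<in> factorizations p n m"
    using assms(1) by (auto simp: delta_def successive_differences_def length_set_def)
  then have "m \<in> S"
    using sum_in_add_submonoid_hull[of "{0..p}" x n] assms(2) by (simp add: factorizations_def)
  then show ?thesis using assms(1) by (auto simp: delta_set_def)
qed

end

theorem theorem19:
  fixes p :: nat and a b :: "nat \<Rightarrow> nat" and S N D :: "nat set"
  assumes "nscs p a b S"
    and "N = {b i - a i | i. i \<in> {1..p}}"
    and "D = delta_set p (compound_seq p a b) S"
  shows "finite D \<and> Min D = Gcd N \<and> N \<subseteq> D \<and> Max D = Max N"
proof -
  interpret compound p a b
    using assms(1) by unfold_locales (simp add: nscs_def)
  have hull: "add_submonoid hull (compound_seq p a b ` {0..p}) = S"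
    using assms(1) by (simp add: nscs_def minimally_generates_def)
  have "b 1 - a 1 \<in> N"
    using params assms(2) by (auto simp: compound_params_def)
  then have N: "finite N" "N \<noteq> {}" using assms(2) by auto
  have ND: "N \<subseteq> D"
    using delta_in_delta_set[OF N_delta hull] assms(2,3) by blast
  have le: "d \<le> Max N" if "d \<in> D" for d
    using that delta_le_Max assms(2,3) by (auto simp: delta_set_def)
  \<comment> \<open>Finiteness is what gives \<open>Min D\<close> and \<open>Max D\<close> their
    intended meaning.\<close>
  then have fin: "finite D" by (meson finite_nat_set_iff_bounded_le)
  obtain m where "Gcd N \<in> delta p (compound_seq p a b) m"
    using Gcd_delta assms(2) by blast
  then have "Gcd N \<in> D" using delta_in_delta_set[OF _ hull] assms(3) by blast
  moreover have "Gcd N \<le> d" if "d \<in> D" for d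
    using that Gcd_dvd_delta assms(2,3) by (auto simp: delta_set_def intro!: dvd_imp_le)
  ultimately have "Min D = Gcd N" using fin by (intro Min_eqI) auto
  moreover have "Max D = Max N"
    using fin le ND Max_in[OF N] by (intro Max_eqI) auto
  ultimately show ?thesis using fin ND by blast
qed

end
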